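(* Let $n\ge 2$ be an integer and $Q=\mathsf{k}[x_1,\dots,x_n]$, where $\mathsf{k}$ is a field with $\operatorname{char}\mathsf{k}=0$. Then the Gorenstein ring $$A=Q/\big((x_1^2,\dots,x_n^2):(x_1+\dots+x_n)^2\big)$$ has the Strong Lefschetz Property.
   Context: Let $S$ be a standard graded Noetherian $\mathsf{k}$-algebra. A homogeneous element $f\in S$ of degree $d\ge 1$ is a maximal rank element if for each $i\ge 0$ the multiplication map $S_i\xrightarrow{\cdot f}S_{i+d}$ has maximal rank (i.e. is injective or surjective). $S$ has the Strong Lefschetz Property if there exists a linear form $f\in S_1$ such that $f^j$ is a maximal rank element of $S$ for every $j\ge 1$. *)

theory Defs
  imports
    "HOL-Algebra.Algebra"
    "HOL-Algebra.Algebraic_Closure_Type"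
    "HOL-Library.Poly_Mapping"
begin

section \<open>Standard graded algebras and the Strong Lefschetz Property\<close>

text \<open>
  The \<open>\<k>\<close>-algebra structure of \<open>R\<close> is the ring homomorphism \<open>\<phi>\<close> from the field \<open>'k\<close>,
  and \<open>S i\<close> is the homogeneous component of degree \<open>i\<close>. Standard graded means that
  the component of degree \<open>0\<close> is \<open>\<k>\<close> itself and that \<open>R\<close> is generated as a \<open>\<k>\<close>-algebra by the
  component of degree \<open>1\<close>.
\<close>

locale standard_graded_algebra = cring R + noetherian_ring R
  for \<phi> :: "'k::field \<Rightarrow> 'a" and R :: "('a, 'b) ring_scheme" (structure)
    and S :: "nat \<Rightarrow> 'a set" +
  assumes structure_map: "\<phi> \<in> ring_hom ring_of_type_algebra R"
    and structure_map_inj: "inj \<phi>"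
    and component_subgroup: "additive_subgroup (S i) R"
    and component_mult: "\<lbrakk>a \<in> S i; b \<in> S j\<rbrakk> \<Longrightarrow> a \<otimes> b \<in> S (i + j)"
    and direct_sum: "a \<in> carrier R \<Longrightarrow>
      \<exists>!c. (\<forall>i. c i \<in> S i) \<and> finite {i. c i \<noteq> \<zero>} \<and> (\<Oplus>i\<in>{i. c i \<noteq> \<zero>}. c i) = a"
    and component_0: "S 0 = range \<phi>"
    and generated: "carrier R = generate_ring R (S 0 \<union> S 1)"

definition maximal_rank_element ::
    "('a, 'b) ring_scheme \<Rightarrow> (nat \<Rightarrow> 'a set) \<Rightarrow> nat \<Rightarrow> 'a \<Rightarrow> bool" where
  "maximal_rank_element R S d f \<longleftrightarrow> d \<ge> 1 \<and> f \<in> S d \<and>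
     (\<forall>i. inj_on (\<lambda>a. a \<otimes>\<^bsub>R\<^esub> f) (S i) \<or> (\<lambda>a. a \<otimes>\<^bsub>R\<^esub> f) ` S i = S (i + d))"

locale strong_lefschetz_algebra = standard_graded_algebra +
  assumes strong_lefschetz:
    "\<exists>f\<in>S 1. \<forall>j\<ge>1. maximal_rank_element R S j (f [^] j)"


section \<open>Polynomial rings\<close>

text \<open>
  A monomial is its exponent vector \<open>nat \<Rightarrow>\<^sub>0 nat\<close>; the type \<open>'k mpoly\<close> carries the convolution
  product, so it is the polynomial ring in variables indexed by all of \<open>nat\<close>.
  The ring \<open>\<k>[x\<^sub>1,\<dots>,x\<^sub>n]\<close> is the subring of polynomials in which only the variables with index
  in \<open>{1..n}\<close> occur.
\<close>

type_synonym 'k mpoly = "(nat \<Rightarrow>\<^sub>0 nat) \<Rightarrow>\<^sub>0 'k"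

definition mpoly_carrier :: "nat \<Rightarrow> 'k::field mpoly set" where
  "mpoly_carrier n = {p. \<forall>m\<in>Poly_Mapping.keys p. Poly_Mapping.keys m \<subseteq> {1..n}}"

definition mpoly_ring :: "nat \<Rightarrow> 'k::field mpoly ring" where
  "mpoly_ring n = ring_of_type_algebra\<lparr>carrier := mpoly_carrier n\<rparr>"

definition mvar :: "nat \<Rightarrow> 'k::field mpoly" where
  "mvar i = Poly_Mapping.single (Poly_Mapping.single i 1) 1"

definition mconst :: "'k::field \<Rightarrow> 'k mpoly" where
  "mconst c = Poly_Mapping.single 0 c"

definition mdeg :: "(nat \<Rightarrow>\<^sub>0 nat) \<Rightarrow> nat" where
  "mdeg m = (\<Sum>i\<in>Poly_Mapping.keys m. Poly_Mapping.lookup m i)"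

definition homog :: "nat \<Rightarrow> nat \<Rightarrow> 'k::field mpoly set" where
  "homog n d = {p \<in> mpoly_carrier n. \<forall>m\<in>Poly_Mapping.keys p. mdeg m = d}"


section \<open>Ideal quotients and quotient rings\<close>

definition colon :: "('a, 'b) ring_scheme \<Rightarrow> 'a set \<Rightarrow> 'a \<Rightarrow> 'a set" where
  "colon R I f = {g \<in> carrier R. g \<otimes>\<^bsub>R\<^esub> f \<in> I}"

definition quot_homog :: "nat \<Rightarrow> 'k::field mpoly set \<Rightarrow> nat \<Rightarrow> 'k mpoly set set" where
  "quot_homog n J d = (\<lambda>p. J +>\<^bsub>mpoly_ring n\<^esub> p) ` homog n d"

definition quot_const :: "nat \<Rightarrow> 'k::field mpoly set \<Rightarrow> 'k \<Rightarrow> 'k mpoly set" where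
  "quot_const n J c = J +>\<^bsub>mpoly_ring n\<^esub> mconst c"


section \<open>Quotients of polynomial rings by homogeneous ideals are standard graded\<close>

text \<open>
  The remainder shows that the ring \<open>\<k>[x\<^sub>1,\<dots>,x\<^sub>n] / ((x\<^sub>1\<^sup>2,\<dots>,x\<^sub>n\<^sup>2) : (x\<^sub>1 + \<dots> + x\<^sub>n)\<^sup>2)\<close> with the
  components \<^const>\<open>quot_homog\<close> is a standard graded Noetherian \<open>\<k>\<close>-algebra; in particular
  the assumptions of \<^locale>\<open>standard_graded_algebra\<close> are met by it.
\<close>

abbreviation "lkp \<equiv> Poly_Mapping.lookup"
abbreviation "kys \<equiv> Poly_Mapping.keys"

lemma mdeg_superset: "finite A \<Longrightarrow> kys m \<subseteq> A \<Longrightarrow> mdeg m = (\<Sum>i\<in>A. lkp m i)"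
  unfolding mdeg_def by (rule sum.mono_neutral_left) (auto simp: in_keys_iff)

lemma mdeg_add: "mdeg (a + b) = mdeg a + mdeg b"
proof -
  let ?A = "kys a \<union> kys b"
  have "kys (a + b) \<subseteq> ?A" by (rule Poly_Mapping.keys_add)
  then show ?thesis
    by (subst (1 2 3) mdeg_superset[of ?A]) (auto simp: lookup_add sum.distrib)
qed

lemma keys_add_nat: "kys (a + b :: nat \<Rightarrow>\<^sub>0 nat) = kys a \<union> kys b"
  by (auto simp: in_keys_iff lookup_add)

lemma mdeg_single [simp]: "mdeg (Poly_Mapping.single i k) = k"
  by (simp add: mdeg_def)

lemma mdeg_zero [simp]: "mdeg 0 = 0"
  by (simp add: mdeg_def)

lemma mdeg_0_iff: "mdeg m = 0 \<longleftrightarrow> m = 0"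
  by (metis mdeg_def sum_eq_0_iff finite_keys in_keys_iff poly_mapping_eqI lookup_zero mdeg_zero)

lemma pc_zero: "0 \<in> mpoly_carrier n"
  and pc_one: "1 \<in> mpoly_carrier n"
  and pc_uminus: "p \<in> mpoly_carrier n \<Longrightarrow> - p \<in> mpoly_carrier n"
  by (auto simp: mpoly_carrier_def)

lemma pc_add: "p \<in> mpoly_carrier n \<Longrightarrow> q \<in> mpoly_carrier n \<Longrightarrow> p + q \<in> mpoly_carrier n"
  unfolding mpoly_carrier_def using Poly_Mapping.keys_add[of p q] by blast

lemma pc_mult: "p \<in> mpoly_carrier n \<Longrightarrow> q \<in> mpoly_carrier n \<Longrightarrow> p * q \<in> mpoly_carrier n"
proof -
  assume *: "p \<in> mpoly_carrier n" "q \<in> mpoly_carrier n"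
  have "kys m \<subseteq> {1..n}" if m: "m \<in> kys (p * q)" for m
  proof -
    obtain a b where "m = a + b" "a \<in> kys p" "b \<in> kys q"
      using subsetD[OF keys_mult m] by blast
    then show ?thesis using * by (simp add: keys_add_nat mpoly_carrier_def)
  qed
  then show ?thesis by (simp add: mpoly_carrier_def)
qed

lemma pc_sum: "(\<And>i. i \<in> A \<Longrightarrow> f i \<in> mpoly_carrier n) \<Longrightarrow> sum f A \<in> mpoly_carrier n"
  by (induct A rule: infinite_finite_induct) (auto simp: pc_zero pc_add)

lemma pc_mconst: "mconst c \<in> mpoly_carrier n"
  by (auto simp: mpoly_carrier_def mconst_def)

lemma pc_mvar: "i \<in> {1..n} \<Longrightarrow> mvar i \<in> mpoly_carrier n"
  by (auto simp: mpoly_carrier_def mvar_def)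

lemma carrier_mpoly_ring [simp]: "carrier (mpoly_ring n) = mpoly_carrier n"
  and mult_mpoly_ring [simp]: "p \<otimes>\<^bsub>mpoly_ring n\<^esub> q = p * q"
  and add_mpoly_ring [simp]: "p \<oplus>\<^bsub>mpoly_ring n\<^esub> q = p + q"
  and one_mpoly_ring [simp]: "\<one>\<^bsub>mpoly_ring n\<^esub> = 1"
  and zero_mpoly_ring [simp]: "\<zero>\<^bsub>mpoly_ring n\<^esub> = 0"
  by (simp_all add: mpoly_ring_def ring_of_type_algebra_def)

lemma cring_mpoly_ring: "cring (mpoly_ring n)"
proof -
  have "\<exists>y\<in>mpoly_carrier n. y + x = 0 \<and> x + y = 0"
    if "x \<in> mpoly_carrier n" for x :: "'a mpoly"
    using pc_uminus[OF that] by force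
  then show ?thesis
    by unfold_locales
      (auto simp: Units_def algebra_simps pc_zero pc_one pc_add pc_mult)
qed

lemma pow_mpoly_ring [simp]: "p [^]\<^bsub>mpoly_ring n\<^esub> (k::nat) = p ^ k"
  by (induct k) (simp_all add: cring.cring_simprules mult.commute monoid.nat_pow_0 nat_pow_def)

lemma finsum_mpoly_ring:
  assumes "\<And>i. i \<in> A \<Longrightarrow> f i \<in> mpoly_carrier n"
  shows "finsum (mpoly_ring n) f A = sum f A"
proof -
  interpret cring "mpoly_ring n" by (rule cring_mpoly_ring)
  show ?thesis using assms
    by (induct A rule: infinite_finite_induct) (auto simp: finsum_insert Pi_def)
qed

lemma a_minus_mpoly_ring:
  "p \<in> mpoly_carrier n \<Longrightarrow> q \<in> mpoly_carrier n \<Longrightarrow> p \<ominus>\<^bsub>mpoly_ring n\<^esub> q = p - q"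
proof -
  assume *: "p \<in> mpoly_carrier n" "q \<in> mpoly_carrier n"
  interpret cring "mpoly_ring n :: 'a mpoly ring" by (rule cring_mpoly_ring)
  have "\<ominus>\<^bsub>mpoly_ring n\<^esub> q = - q"
    using * minus_equality[of "-q" q] pc_uminus by auto
  then show ?thesis by (simp add: a_minus_def)
qed

lemma mpoly_expand: "p = (\<Sum>m\<in>kys p. Poly_Mapping.single m (lkp p m))"
  by (rule poly_mapping_eqI)
    (simp add: lookup_sum lookup_single when_def in_keys_iff if_distrib sum.delta' sum.delta cong: if_cong)

definition hcomp :: "nat \<Rightarrow> 'k::field mpoly \<Rightarrow> 'k mpoly" where
  "hcomp d p = (\<Sum>m\<in>{m\<in>kys p. mdeg m = d}. Poly_Mapping.single m (lkp p m))"

lemma lookup_hcomp: "lkp (hcomp d p) m = (if mdeg m = d then lkp p m else 0)"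
  unfolding hcomp_def
  by (simp add: lookup_sum lookup_single when_def in_keys_iff if_distrib sum.delta' sum.delta cong: if_cong)

lemma hcomp_homog: "p \<in> mpoly_carrier n \<Longrightarrow> hcomp d p \<in> homog n d"
  unfolding homog_def mpoly_carrier_def by (auto simp: in_keys_iff lookup_hcomp split: if_splits)

lemma hcomp_homog_same: "p \<in> homog n d \<Longrightarrow> hcomp e p = (if e = d then p else 0)"
  by (rule poly_mapping_eqI) (auto simp: lookup_hcomp homog_def in_keys_iff)

lemma hcomp_zero: "hcomp d 0 = 0"
  by (rule poly_mapping_eqI) (simp add: lookup_hcomp)
lemma hcomp_add: "hcomp d (p + q) = hcomp d p + hcomp d q"
  by (rule poly_mapping_eqI) (simp add: lookup_hcomp lookup_add)
lemma hcomp_diff: "hcomp d (p - q) = hcomp d p - hcomp d q"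
  by (rule poly_mapping_eqI) (simp add: lookup_hcomp lookup_minus)
lemma hcomp_sum: "hcomp d (sum f A) = (\<Sum>i\<in>A. hcomp d (f i))"
  by (induct A rule: infinite_finite_induct) (auto simp: hcomp_zero hcomp_add)

lemma hcomp_finite: "finite {d. hcomp d p \<noteq> 0}"
proof -
  have "{d. hcomp d p \<noteq> 0} \<subseteq> mdeg ` kys p"
    by (auto simp: hcomp_def) (metis (mono_tags, lifting) empty_iff image_eqI mem_Collect_eq sum.neutral)
  then show ?thesis by (rule finite_subset) simp
qed

lemma hcomp_total: "finite A \<Longrightarrow> {d. hcomp d p \<noteq> 0} \<subseteq> A \<Longrightarrow> (\<Sum>d\<in>A. hcomp d p) = p"
proof (rule poly_mapping_eqI)
  fix m assume A: "finite A" "{d. hcomp d p \<noteq> 0} \<subseteq> A"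
  have "lkp p m = 0" if "mdeg m \<notin> A"
  proof -
    have "hcomp (mdeg m) p = 0" using A that by auto
    then show ?thesis by (metis lookup_hcomp lookup_zero)
  qed
  then show "lkp (\<Sum>d\<in>A. hcomp d p) m = lkp p m"
    using A by (auto simp: lookup_sum lookup_hcomp sum.delta)
qed

lemma homog_subset: "homog n d \<subseteq> mpoly_carrier n" by (auto simp: homog_def)

lemma homog_zero: "0 \<in> homog n d"
  and homog_uminus: "p \<in> homog n d \<Longrightarrow> - p \<in> homog n d"
  by (auto simp: homog_def mpoly_carrier_def)

lemma homog_add: "p \<in> homog n d \<Longrightarrow> q \<in> homog n d \<Longrightarrow> p + q \<in> homog n d"
  unfolding homog_def using pc_add[of p n q] Poly_Mapping.keys_add[of p q] by blast

lemma homog_mult: "p \<in> homog n d \<Longrightarrow> q \<in> homog n e \<Longrightarrow> p * q \<in> homog n (d + e)"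
proof -
  assume *: "p \<in> homog n d" "q \<in> homog n e"
  have "mdeg m = d + e" if m: "m \<in> kys (p * q)" for m
  proof -
    obtain a b where "m = a + b" "a \<in> kys p" "b \<in> kys q"
      using subsetD[OF keys_mult m] by blast
    then show ?thesis using * by (simp add: mdeg_add homog_def)
  qed
  then show ?thesis using * pc_mult[of p n q] by (simp add: homog_def)
qed

lemma homog_sum: "(\<And>i. i \<in> A \<Longrightarrow> f i \<in> homog n d) \<Longrightarrow> sum f A \<in> homog n d"
  by (induct A rule: infinite_finite_induct) (auto simp: homog_zero homog_add)

lemma homog_0: "homog n 0 = range mconst"
proof (intro equalityI subsetI)
  fix p :: "'a mpoly" assume "p \<in> homog n 0"
  then have "kys p \<subseteq> {0}" by (auto simp: homog_def mdeg_0_iff)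
  then have "p = mconst (lkp p 0)"
    unfolding mconst_def by (intro poly_mapping_eqI) (auto simp: lookup_single when_def in_keys_iff)
  then show "p \<in> range mconst" by blast
qed (auto simp: homog_def mpoly_carrier_def mconst_def split: if_splits)

lemma homog_mvar: "i \<in> {1..n} \<Longrightarrow> mvar i \<in> homog n 1"
  using pc_mvar[of i n] by (auto simp: homog_def) (auto simp: mvar_def)

lemma hcomp_mult_homog:
  assumes "p \<in> mpoly_carrier n" "q \<in> homog n e"
  shows "hcomp (d + e) (p * q) = hcomp d p * q"
proof -
  let ?A = "insert d {d. hcomp d p \<noteq> 0}"
  have f: "finite ?A" using hcomp_finite by simp
  have "p = (\<Sum>i\<in>?A. hcomp i p)" by (rule hcomp_total[OF f, symmetric]) auto
  then have "p * q = (\<Sum>i\<in>?A. hcomp i p * q)" by (metis sum_distrib_right)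
  then have "hcomp (d + e) (p * q) = (\<Sum>i\<in>?A. hcomp (d + e) (hcomp i p * q))"
    by (simp only: hcomp_sum)
  also have "\<dots> = (\<Sum>i\<in>?A. if i = d then hcomp d p * q else 0)"
    by (rule sum.cong[OF refl])
      (auto simp: hcomp_homog_same[OF homog_mult[OF hcomp_homog[OF assms(1)] assms(2)]])
  also have "\<dots> = hcomp d p * q" using f by simp
  finally show ?thesis .
qed

lemma mvar_square: "mvar i * mvar i = Poly_Mapping.single (Poly_Mapping.single i 2) 1"
  by (simp add: mvar_def mult_single single_add[symmetric] numeral_2_eq_2)

lemma single_split:
  fixes m :: "nat \<Rightarrow>\<^sub>0 nat" assumes "i \<in> kys m"
  obtains m' where "m = Poly_Mapping.single i 1 + m'" "mdeg m = Suc (mdeg m')" "kys m' \<subseteq> kys m"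
proof -
  have "m = Poly_Mapping.single i 1 + (m - Poly_Mapping.single i 1)"
    using assms by (intro poly_mapping_eqI)
      (auto simp: lookup_add lookup_minus lookup_single when_def in_keys_iff)
  then show ?thesis
    using that mdeg_add[of "Poly_Mapping.single i 1"] keys_add_nat mdeg_single
    by (metis One_nat_def plus_1_eq_Suc sup_ge2)
qed

lemma square_dvd_split:
  fixes m :: "nat \<Rightarrow>\<^sub>0 nat" assumes "2 \<le> lkp m i"
  obtains m' where "m = m' + Poly_Mapping.single i 2" "kys m' \<subseteq> kys m"
proof -
  have "m = (m - Poly_Mapping.single i 2) + Poly_Mapping.single i 2"
    using assms by (intro poly_mapping_eqI)
      (auto simp: lookup_add lookup_minus lookup_single when_def in_keys_iff)
  then show ?thesis
    using that keys_add_nat by (metis sup_ge1)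
qed

lemma pc_single: "kys m \<subseteq> {1..n} \<Longrightarrow> Poly_Mapping.single m c \<in> mpoly_carrier n"
  by (auto simp: mpoly_carrier_def split: if_splits)

text \<open>Membership in \<open>(x\<^sub>1\<^sup>2,\<dots>,x\<^sub>n\<^sup>2)\<close>, read off the support.\<close>

lemma squares_ideal_eq:
  "Idl\<^bsub>mpoly_ring n\<^esub> {mvar i [^]\<^bsub>mpoly_ring n\<^esub> (2::nat) | i. i \<in> {1..n}} =
   {p \<in> mpoly_carrier n. \<forall>m\<in>kys p. \<exists>i. 2 \<le> lkp m i}" (is "?I = ?M")
proof -
  interpret Q: cring "mpoly_ring n :: 'a mpoly ring" by (rule cring_mpoly_ring)
  let ?G = "{mvar i [^]\<^bsub>mpoly_ring n\<^esub> (2::nat) | i. i \<in> {1..n}} :: 'a mpoly set"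
  have G: "?G \<subseteq> carrier (mpoly_ring n)"
    by (auto simp: power2_eq_square intro!: pc_mult pc_mvar)
  interpret I: ideal ?I "mpoly_ring n" by (rule Q.genideal_ideal[OF G])
  have absorb: "p * q \<in> ?M" if "p \<in> ?M" "q \<in> mpoly_carrier n" for p q :: "'a mpoly"
  proof -
    have "\<exists>i. 2 \<le> lkp m i" if m: "m \<in> kys (p * q)" for m
    proof -
      obtain a b where "m = a + b" "a \<in> kys p" "b \<in> kys q"
        using subsetD[OF keys_mult m] by blast
      then show ?thesis using \<open>p \<in> ?M\<close> by (auto simp: lookup_add) (metis trans_le_add1)
    qed
    then show ?thesis using that pc_mult by blast
  qed
  have "ideal ?M (mpoly_ring n)"
  proof (rule idealI[OF Q.ring_axioms])
    show "subgroup ?M (add_monoid (mpoly_ring n))"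
    proof (rule Q.add.subgroupI)
      fix a b assume ab: "a \<in> ?M" "b \<in> ?M"
      have "kys (a + b) \<subseteq> kys a \<union> kys b" by (rule Poly_Mapping.keys_add)
      then show "a \<oplus>\<^bsub>mpoly_ring n\<^esub> b \<in> ?M" using ab pc_add by auto
      have "\<ominus>\<^bsub>mpoly_ring n\<^esub> a = - a"
        using ab Q.minus_equality[of "- a" a] pc_uminus by auto
      then show "\<ominus>\<^bsub>mpoly_ring n\<^esub> a \<in> ?M"
        unfolding \<open>\<ominus>\<^bsub>mpoly_ring n\<^esub> a = - a\<close> using ab pc_uminus by auto
    qed (auto intro: exI[of _ "0::'a mpoly"] simp: pc_zero)
  qed (use absorb in \<open>auto simp: mult.commute\<close>)
  moreover have "?G \<subseteq> ?M"
  proof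
    fix p :: "'a mpoly" assume "p \<in> ?G"
    then obtain i where i: "i \<in> {1..n}" "p = mvar i * mvar i" by (auto simp: power2_eq_square)
    then have "p \<in> mpoly_carrier n" by (simp add: pc_mult pc_mvar)
    moreover have "kys p = {Poly_Mapping.single i 2}" using i by (simp add: mvar_square)
    moreover have "2 \<le> lkp (Poly_Mapping.single i (2::nat)) i" by simp
    ultimately show "p \<in> ?M" by (auto intro: exI[of _ i])
  qed
  ultimately have "?I \<subseteq> ?M" by (rule Q.genideal_minimal)
  moreover have "?M \<subseteq> ?I"
  proof
    fix p assume p: "p \<in> ?M"
    have single: "Poly_Mapping.single m (lkp p m) \<in> ?I" if m: "m \<in> kys p" for m
    proof -
      obtain i where i: "2 \<le> lkp m i" using p m by auto
      have km: "kys m \<subseteq> {1..n}" using p m by (auto simp: mpoly_carrier_def)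
      moreover have "i \<in> kys m" using i by (auto simp: in_keys_iff)
      ultimately have i': "i \<in> {1..n}" by blast
      obtain m' where m': "m = m' + Poly_Mapping.single i 2" "kys m' \<subseteq> kys m"
        using square_dvd_split[OF i] by blast
      have "mvar i * mvar i \<in> ?I"
        using Q.genideal_self[OF G] i' by (auto simp: power2_eq_square)
      then have "Poly_Mapping.single m' (lkp p m) * (mvar i * mvar i) \<in> ?I"
        using I.I_l_closed[of "mvar i * mvar i" "Poly_Mapping.single m' (lkp p m)"]
          pc_single[of m' n] m'(2) km by auto
      then show ?thesis by (simp add: mvar_square mult_single m'(1)[symmetric])
    qed
    have sums: "sum f A \<in> ?I" if "\<And>m. m \<in> A \<Longrightarrow> f m \<in> ?I" for f :: "(nat \<Rightarrow>\<^sub>0 nat) \<Rightarrow> 'a mpoly" and A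
      using that
    proof (induct A rule: infinite_finite_induct)
      case (insert x F)
      then show ?case using I.a_closed[of "f x" "sum f F"] by simp
    qed (use I.zero_closed in auto)
    have "(\<Sum>m\<in>kys p. Poly_Mapping.single m (lkp p m)) \<in> ?I" by (rule sums) (rule single)
    then show "p \<in> ?I" by (simp only: mpoly_expand[symmetric])
  qed
  ultimately show ?thesis by blast
qed

locale homogeneous_quotient =
  fixes n :: nat and J :: "'k::field mpoly set"
  assumes J_ideal: "ideal J (mpoly_ring n)"
    and J_homogeneous: "g \<in> J \<Longrightarrow> hcomp d g \<in> J"
    and J_squares: "i \<in> {1..n} \<Longrightarrow> mvar i * mvar i \<in> J"
    and J_proper: "1 \<notin> J"
begin

abbreviation "Q \<equiv> mpoly_ring n :: 'k mpoly ring"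
abbreviation "A \<equiv> Q Quot J"
abbreviation "coset_of p \<equiv> J +>\<^bsub>Q\<^esub> p"

sublocale Q: cring Q by (rule cring_mpoly_ring)
sublocale J: ideal J Q by (rule J_ideal)
sublocale A: cring A by (rule J.quotient_is_cring[OF Q.cring_axioms])
sublocale h: ring_hom_cring Q A "\<lambda>p. coset_of p" by (rule J.rcos_ring_hom_cring[OF Q.cring_axioms])

lemma J_sub: "g \<in> J \<Longrightarrow> g \<in> mpoly_carrier n" using J.a_subset by auto
lemma J_add: "g \<in> J \<Longrightarrow> g' \<in> J \<Longrightarrow> g + g' \<in> J" using J.a_closed[of g g'] by simp
lemma J_zero: "0 \<in> J" using J.zero_closed by simp
lemma J_mult: "g \<in> J \<Longrightarrow> p \<in> mpoly_carrier n \<Longrightarrow> p * g \<in> J" using J.I_l_closed[of g p] by simp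
lemma J_sum: "(\<And>i. i \<in> Z \<Longrightarrow> f i \<in> J) \<Longrightarrow> sum f Z \<in> J"
  by (induct Z rule: infinite_finite_induct) (auto simp: J_zero J_add)

lemma carrier_A: "carrier A = coset_of ` mpoly_carrier n"
  by (auto simp: FactRing_def A_RCOSETS_def RCOSETS_def a_r_coset_def)

lemma zero_A: "\<zero>\<^bsub>A\<^esub> = J" by (simp add: FactRing_def)

lemma coset_eq:
  assumes "p \<in> mpoly_carrier n" "q \<in> mpoly_carrier n"
  shows "coset_of p = coset_of q \<longleftrightarrow> p - q \<in> J"
proof
  have *: "p - q \<in> J \<longleftrightarrow> p \<in> coset_of q"
    using J.a_rcos_module[of q p] assms a_minus_mpoly_ring[OF assms]
    by (simp add: a_minus_def)
  show "coset_of p = coset_of q \<Longrightarrow> p - q \<in> J" using * J.a_rcos_self[of p] assms by auto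
  show "p - q \<in> J \<Longrightarrow> coset_of p = coset_of q" using * J.a_repr_independence'[of p q] assms by auto
qed

lemma coset_0: "coset_of p = \<zero>\<^bsub>A\<^esub> \<longleftrightarrow> p \<in> J" if "p \<in> mpoly_carrier n"
  using coset_eq[OF that pc_zero] h.hom_zero by simp

lemma coset_add: "p \<in> mpoly_carrier n \<Longrightarrow> q \<in> mpoly_carrier n \<Longrightarrow> coset_of p \<oplus>\<^bsub>A\<^esub> coset_of q = coset_of (p + q)"
  using h.hom_add[of p q] by simp
lemma coset_mult: "p \<in> mpoly_carrier n \<Longrightarrow> q \<in> mpoly_carrier n \<Longrightarrow> coset_of p \<otimes>\<^bsub>A\<^esub> coset_of q = coset_of (p * q)"
  using h.hom_mult[of p q] by simp
lemma coset_one: "coset_of 1 = \<one>\<^bsub>A\<^esub>" using h.hom_one by simp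
lemma coset_uminus: "p \<in> mpoly_carrier n \<Longrightarrow> \<ominus>\<^bsub>A\<^esub> coset_of p = coset_of (- p)"
  using A.minus_equality[of "coset_of (-p)" "coset_of p"] h.hom_closed[of p] h.hom_closed[of "-p"] pc_uminus[of p n]
  by (simp add: coset_add) (metis coset_0 J_zero pc_zero)

lemma coset_sum:
  assumes "\<And>i. i \<in> Z \<Longrightarrow> f i \<in> mpoly_carrier n"
  shows "finsum A (\<lambda>i. coset_of (f i)) Z = coset_of (sum f Z)"
  using h.hom_finsum[of f Z] assms finsum_mpoly_ring[of Z f n] by (auto simp: Pi_def o_def)

lemma coset_closed: "p \<in> mpoly_carrier n \<Longrightarrow> coset_of p \<in> carrier A"
  by (simp add: carrier_A)

lemma component_closed: "a \<in> quot_homog n J d \<Longrightarrow> a \<in> carrier A"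
  using homog_subset by (auto simp: quot_homog_def intro!: coset_closed)

lemma structure_map_A: "quot_const n J \<in> ring_hom ring_of_type_algebra A"
  by (rule ring_hom_memI)
    (auto simp: quot_const_def ring_of_type_algebra_def coset_closed pc_mconst coset_mult coset_add coset_one[symmetric]
      mconst_def[of 1] mconst_def mult_single single_add pc_single)

lemma structure_map_inj_A: "inj (quot_const n J)"
proof (rule injI)
  fix c d assume "quot_const n J c = quot_const n J d"
  then have *: "mconst (c - d) \<in> J"
    by (simp add: quot_const_def coset_eq pc_mconst) (simp add: mconst_def single_diff)
  show "c = d"
  proof (rule ccontr)
    assume "c \<noteq> d"
    then have "mconst (inverse (c - d)) * mconst (c - d) = 1"
      by (simp add: mconst_def mult_single)
    then show False using J_mult[OF * pc_mconst[of "inverse (c - d)"]] J_proper by simp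
  qed
qed

lemma component_subgroup_A: "additive_subgroup (quot_homog n J d) A"
proof (rule additive_subgroup.intro, rule A.add.subgroupI)
  show "quot_homog n J d \<subseteq> carrier A" using component_closed by auto
  show "quot_homog n J d \<noteq> {}" using homog_zero by (auto simp: quot_homog_def)
next
  fix a assume "a \<in> quot_homog n J d"
  then obtain p where p: "p \<in> homog n d" "a = coset_of p" by (auto simp: quot_homog_def)
  then have "\<ominus>\<^bsub>A\<^esub> a = coset_of (- p)" using coset_uminus homog_subset by blast
  then show "\<ominus>\<^bsub>A\<^esub> a \<in> quot_homog n J d"
    using homog_uminus[OF p(1)] by (auto simp: quot_homog_def)
  fix b assume "b \<in> quot_homog n J d"
  then obtain q where q: "q \<in> homog n d" "b = coset_of q" by (auto simp: quot_homog_def)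
  then have "a \<oplus>\<^bsub>A\<^esub> b = coset_of (p + q)" using p coset_add homog_subset by blast
  then show "a \<oplus>\<^bsub>A\<^esub> b \<in> quot_homog n J d"
    using homog_add[OF p(1) q(1)] by (auto simp: quot_homog_def)
qed

lemma component_mult_A:
  assumes "a \<in> quot_homog n J i" "b \<in> quot_homog n J j"
  shows "a \<otimes>\<^bsub>A\<^esub> b \<in> quot_homog n J (i + j)"
proof -
  obtain p q where "p \<in> homog n i" "a = coset_of p" "q \<in> homog n j" "b = coset_of q"
    using assms by (auto simp: quot_homog_def)
  moreover from this have "a \<otimes>\<^bsub>A\<^esub> b = coset_of (p * q)" using coset_mult homog_subset by blast
  ultimately show ?thesis unfolding quot_homog_def using homog_mult by blast
qed

lemma direct_sum_A:
  assumes "a \<in> carrier A"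
  shows "\<exists>!c. (\<forall>i. c i \<in> quot_homog n J i) \<and> finite {i. c i \<noteq> \<zero>\<^bsub>A\<^esub>} \<and>
    finsum A c {i. c i \<noteq> \<zero>\<^bsub>A\<^esub>} = a"
proof -
  obtain p where p: "p \<in> mpoly_carrier n" "a = coset_of p" using assms by (auto simp: carrier_A)
  define c0 where "c0 = (\<lambda>i. coset_of (hcomp i p))"
  have hp: "hcomp i p \<in> mpoly_carrier n" for i using hcomp_homog[OF p(1)] homog_subset by blast
  have c0: "c0 i \<in> quot_homog n J i" for i
    unfolding c0_def quot_homog_def using hcomp_homog[OF p(1)] by blast
  let ?N = "{i. c0 i \<noteq> \<zero>\<^bsub>A\<^esub>}" and ?P = "{i. hcomp i p \<noteq> 0}"
  have sub: "?N \<subseteq> ?P" using coset_0[OF hp] J_zero by (auto simp: c0_def) 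
  have fin: "finite ?N" using sub hcomp_finite finite_subset by blast
  have "finsum A c0 ?N = finsum A c0 ?P"
    by (rule A.add.finprod_mono_neutral_cong_left[OF hcomp_finite sub])
      (use component_closed[OF c0] in auto)
  also have "\<dots> = coset_of (\<Sum>i\<in>?P. hcomp i p)" unfolding c0_def using hp by (intro coset_sum) auto
  also have "(\<Sum>i\<in>?P. hcomp i p) = p" by (rule hcomp_total[OF hcomp_finite]) auto
  finally have sum0: "finsum A c0 ?N = a" using p by simp
  show ?thesis
  proof (rule ex1I[of _ c0])
    show "(\<forall>i. c0 i \<in> quot_homog n J i) \<and> finite ?N \<and> finsum A c0 ?N = a"
      using c0 fin sum0 by blast
  next
    fix c assume c: "(\<forall>i. c i \<in> quot_homog n J i) \<and> finite {i. c i \<noteq> \<zero>\<^bsub>A\<^esub>} \<and>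
      finsum A c {i. c i \<noteq> \<zero>\<^bsub>A\<^esub>} = a"
    let ?C = "{i. c i \<noteq> \<zero>\<^bsub>A\<^esub>}"
    have "\<exists>q. q \<in> homog n i \<and> c i = coset_of q \<and> (c i = \<zero>\<^bsub>A\<^esub> \<longrightarrow> q = 0)" for i
    proof (cases "c i = \<zero>\<^bsub>A\<^esub>")
      case True
      then show ?thesis using homog_zero coset_0[OF pc_zero] J_zero by (intro exI[of _ 0]) auto
    next
      case False
      then show ?thesis using c by (auto simp: quot_homog_def)
    qed
    then obtain q where q: "\<And>i. q i \<in> homog n i" "\<And>i. c i = coset_of (q i)"
      "\<And>i. c i = \<zero>\<^bsub>A\<^esub> \<Longrightarrow> q i = 0" by metis
    have qc: "q i \<in> mpoly_carrier n" for i using q(1) homog_subset by blast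
    have "a = finsum A (\<lambda>i. coset_of (q i)) ?C" using c q(2) by (metis (no_types, lifting) ext)
    also have "\<dots> = coset_of (sum q ?C)" using qc by (intro coset_sum) auto
    finally have "sum q ?C - p \<in> J" using p coset_eq[OF pc_sum p(1)] qc by metis
    then have *: "hcomp i (sum q ?C) - hcomp i p \<in> J" for i
      using J_homogeneous[of _ i] by (simp add: hcomp_diff[symmetric])
    have "hcomp i (sum q ?C) = q i" for i
    proof -
      have "hcomp i (sum q ?C) = (\<Sum>j\<in>?C. if i = j then q j else 0)"
        unfolding hcomp_sum by (rule sum.cong) (simp_all add: hcomp_homog_same[OF q(1)])
      also have "\<dots> = q i" using c q(3)[of i] by (simp add: sum.delta)
      finally show ?thesis .
    qed
    then have "c i = c0 i" for i
      using *[of i] coset_eq[OF qc hp] q(2) by (simp add: c0_def)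
    then show "c = c0" by blast
  qed
qed

lemma component_0_A: "quot_homog n J 0 = range (quot_const n J)"
  by (auto simp: quot_homog_def homog_0 quot_const_def)

lemma generated_A: "carrier A = generate_ring A (quot_homog n J 0 \<union> quot_homog n J 1)" (is "_ = ?G")
proof
  show "?G \<subseteq> carrier A" by (rule A.generate_ring_incl) (use component_closed in auto)
  have const: "coset_of (mconst c) \<in> ?G" for c
    by (rule generate_ring.incl) (auto simp: quot_homog_def homog_0)
  have monom: "coset_of (Poly_Mapping.single m c) \<in> ?G" if "kys m \<subseteq> {1..n}" for m c
    using that
  proof (induct "mdeg m" arbitrary: m)
    case 0
    then show ?case using const[of c] by (simp add: mdeg_0_iff mconst_def)
  next
    case (Suc k)
    then obtain i where i: "i \<in> kys m" by (metis all_not_in_conv keys_eq_empty mdeg_zero nat.distinct(1))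
    then obtain m' where m': "m = Poly_Mapping.single i 1 + m'" "mdeg m = Suc (mdeg m')" "kys m' \<subseteq> kys m"
      by (rule single_split)
    have i': "i \<in> {1..n}" using i Suc by blast
    have "coset_of (mvar i) \<in> ?G"
      by (rule generate_ring.incl) (use homog_mvar[OF i'] in \<open>auto simp: quot_homog_def\<close>)
    moreover have "coset_of (Poly_Mapping.single m' c) \<in> ?G" using Suc m' by auto
    ultimately have "coset_of (mvar i) \<otimes>\<^bsub>A\<^esub> coset_of (Poly_Mapping.single m' c) \<in> ?G"
      by (rule generate_ring.eng_mult)
    also have "coset_of (mvar i) \<otimes>\<^bsub>A\<^esub> coset_of (Poly_Mapping.single m' c) = coset_of (Poly_Mapping.single m c)"
      using m' Suc.prems by (subst coset_mult[OF pc_mvar[OF i'] pc_single]) (auto simp: mvar_def mult_single)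
    finally show ?case .
  qed
  have sums: "coset_of (sum f Z) \<in> ?G" if "\<And>m. m \<in> Z \<Longrightarrow> f m \<in> mpoly_carrier n" "\<And>m. m \<in> Z \<Longrightarrow> coset_of (f m) \<in> ?G"
    for f :: "(nat \<Rightarrow>\<^sub>0 nat) \<Rightarrow> 'k mpoly" and Z
    using that
  proof (induct Z rule: infinite_finite_induct)
    case (insert x F)
    then show ?case
      using generate_ring.eng_add[of "coset_of (f x)" A _ "coset_of (sum f F)"] by (simp add: coset_add pc_sum)
  qed (use const[of 0] in \<open>auto simp: mconst_def\<close>)
  show "carrier A \<subseteq> ?G"
  proof
    fix a assume "a \<in> carrier A"
    then obtain p where p: "p \<in> mpoly_carrier n" "a = coset_of p" by (auto simp: carrier_A)
    have "coset_of (\<Sum>m\<in>kys p. Poly_Mapping.single m (lkp p m)) \<in> ?G"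
      using p by (intro sums monom pc_single) (auto simp: mpoly_carrier_def)
    then show "a \<in> ?G" using p mpoly_expand[of p] by simp
  qed
qed

lemma noetherian_A: "noetherian_ring A"
proof (rule A.noetherian_ringI)
  fix K assume K: "ideal K A"
  then interpret K: ideal K A .
  define scl where "scl = (\<lambda>c (p::'k mpoly). mconst c * p)"
  interpret V: vector_space scl
    by unfold_locales
      (simp_all add: scl_def mconst_def algebra_simps single_add mult_single flip: mult.assoc)
  define SF where "SF = {m :: nat \<Rightarrow>\<^sub>0 nat. kys m \<subseteq> {1..n} \<and> (\<forall>i. lkp m i \<le> 1)}"
  have "inj_on kys SF"
  proof (rule inj_onI)
    fix a b assume ab: "a \<in> SF" "b \<in> SF" "kys a = kys b"
    have "lkp a i = lkp b i" for i
    proof -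
      have "lkp a i \<le> 1" "lkp b i \<le> 1" "lkp a i = 0 \<longleftrightarrow> lkp b i = 0"
        using ab by (simp_all add: SF_def flip: not_in_keys_iff_lookup_eq_zero)
      then show ?thesis by linarith
    qed
    then show "a = b" by (rule poly_mapping_eqI)
  qed
  moreover have "kys ` SF \<subseteq> Pow {1..n}" by (auto simp: SF_def)
  ultimately have finSF: "finite SF" by (metis finite_Pow_iff finite_atLeastAtMost inj_on_finite)
  define T where "T = (\<lambda>m. Poly_Mapping.single m (1::'k)) ` SF"
  define W where "W = {p. kys p \<subseteq> SF \<and> p \<in> mpoly_carrier n \<and> coset_of p \<in> K}"
  have WT: "W \<subseteq> V.span T"
  proof
    fix p assume "p \<in> W"
    then have "kys p \<subseteq> SF" by (simp add: W_def)
    then have "(\<Sum>m\<in>kys p. scl (lkp p m) (Poly_Mapping.single m 1)) \<in> V.span T"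
      by (intro V.span_sum V.span_scale V.span_base) (auto simp: T_def)
    also have "(\<Sum>m\<in>kys p. scl (lkp p m) (Poly_Mapping.single m 1)) = p"
      by (subst (3) mpoly_expand) (simp add: scl_def mconst_def mult_single)
    finally show "p \<in> V.span T" .
  qed
  obtain B where B: "B \<subseteq> W" "V.independent B" "W \<subseteq> V.span B"
    using V.maximal_independent_subset by blast
  have finB: "finite B"
    using V.independent_span_bound[of T B] finSF B WT by (auto simp: T_def)
  have Bc: "B \<subseteq> mpoly_carrier n" using B(1) by (auto simp: W_def)
  have cB: "coset_of ` B \<subseteq> carrier A" using Bc coset_closed by blast
  interpret L: ideal "Idl\<^bsub>A\<^esub> (coset_of ` B)" A by (rule A.genideal_ideal[OF cB])
  have "K = Idl\<^bsub>A\<^esub> (coset_of ` B)"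
  proof
    show "Idl\<^bsub>A\<^esub> (coset_of ` B) \<subseteq> K" by (rule A.genideal_minimal[OF K]) (use B(1) in \<open>auto simp: W_def\<close>)
    have "V.subspace {p \<in> mpoly_carrier n. coset_of p \<in> Idl\<^bsub>A\<^esub> (coset_of ` B)}"
    proof (rule V.subspaceI)
      show "0 \<in> {p \<in> mpoly_carrier n. coset_of p \<in> Idl\<^bsub>A\<^esub> (coset_of ` B)}"
        using L.zero_closed coset_0[OF pc_zero] J_zero pc_zero by auto
    next
      fix p q assume "p \<in> {p \<in> mpoly_carrier n. coset_of p \<in> Idl\<^bsub>A\<^esub> (coset_of ` B)}"
        "q \<in> {p \<in> mpoly_carrier n. coset_of p \<in> Idl\<^bsub>A\<^esub> (coset_of ` B)}"
      then show "p + q \<in> {p \<in> mpoly_carrier n. coset_of p \<in> Idl\<^bsub>A\<^esub> (coset_of ` B)}"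
        using L.a_closed[of "coset_of p" "coset_of q"] by (simp add: coset_add pc_add)
    next
      fix c p assume "p \<in> {p \<in> mpoly_carrier n. coset_of p \<in> Idl\<^bsub>A\<^esub> (coset_of ` B)}"
      then show "scl c p \<in> {p \<in> mpoly_carrier n. coset_of p \<in> Idl\<^bsub>A\<^esub> (coset_of ` B)}"
        using L.I_l_closed[of "coset_of p" "coset_of (mconst c)"]
        by (simp add: coset_mult pc_mult pc_mconst coset_closed scl_def)
    qed
    moreover have "B \<subseteq> {p \<in> mpoly_carrier n. coset_of p \<in> Idl\<^bsub>A\<^esub> (coset_of ` B)}"
      using Bc A.genideal_self[OF cB] by auto
    ultimately have span: "V.span B \<subseteq> {p \<in> mpoly_carrier n. coset_of p \<in> Idl\<^bsub>A\<^esub> (coset_of ` B)}"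
      by (rule V.span_minimal[rotated])
    show "K \<subseteq> Idl\<^bsub>A\<^esub> (coset_of ` B)"
    proof
      fix a assume a: "a \<in> K"
      then obtain p where p: "p \<in> mpoly_carrier n" "a = coset_of p" using K.a_subset by (auto simp: carrier_A)
      define r where "r = (\<Sum>m\<in>kys p \<inter> SF. Poly_Mapping.single m (lkp p m))"
      define s where "s = (\<Sum>m\<in>kys p - SF. Poly_Mapping.single m (lkp p m))"
      have prs: "p = r + s"
        unfolding r_def s_def by (subst mpoly_expand) (simp add: sum.Int_Diff[of "kys p" _ SF])
      have km: "kys m \<subseteq> {1..n}" if "m \<in> kys p" for m using p that by (auto simp: mpoly_carrier_def)
      have "Poly_Mapping.single m (lkp p m) \<in> J" if m: "m \<in> kys p - SF" for m
      proof -
        obtain i where "\<not> lkp m i \<le> 1" using m km[of m] by (auto simp: SF_def)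
        then have i: "2 \<le> lkp m i" by simp
        then have "i \<in> kys m" by (auto simp: in_keys_iff)
        then have i': "i \<in> {1..n}" using km m by blast
        obtain m' where m': "m = m' + Poly_Mapping.single i 2" "kys m' \<subseteq> kys m"
          using square_dvd_split[OF i] by blast
        have "Poly_Mapping.single m' (lkp p m) * (mvar i * mvar i) \<in> J"
          using m' km[of m] m by (intro J_mult J_squares[OF i'] pc_single) auto
        then show ?thesis by (simp add: mvar_square mult_single m'(1)[symmetric])
      qed
      then have sJ: "s \<in> J" unfolding s_def by (rule J_sum)
      have rc: "r \<in> mpoly_carrier n" unfolding r_def by (intro pc_sum pc_single km) auto
      have "coset_of p = coset_of r" using coset_eq[OF p(1) rc] sJ prs by simp
      moreover have "kys r \<subseteq> SF"
      proof
        fix m assume "m \<in> kys r"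
        then have "lkp r m \<noteq> 0" by (simp add: in_keys_iff)
        then show "m \<in> SF"
          unfolding r_def by (auto simp: lookup_sum lookup_single when_def elim!: sum.not_neutral_contains_not_neutral split: if_splits)
      qed
      ultimately have "r \<in> W" using rc a p by (simp add: W_def)
      then have "coset_of r \<in> Idl\<^bsub>A\<^esub> (coset_of ` B)" using B(3) span by blast
      then show "a \<in> Idl\<^bsub>A\<^esub> (coset_of ` B)" using \<open>coset_of p = coset_of r\<close> p by simp
    qed
  qed
  then show "\<exists>Z\<subseteq>carrier A. finite Z \<and> K = Idl\<^bsub>A\<^esub> Z" using cB finB by blast
qed

theorem standard_graded: "standard_graded_algebra (quot_const n J) A (quot_homog n J)"
  by (intro standard_graded_algebra.intro standard_graded_algebra_axioms.intro A.cring_axioms noetherian_A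
      structure_map_A structure_map_inj_A component_subgroup_A component_mult_A direct_sum_A
      component_0_A generated_A)

end

lemma linear_form_square_notin:
  assumes "n \<ge> 2"
  shows "\<exists>m\<in>kys ((\<Sum>i\<in>{1..n}. mvar i :: 'k::field_char_0 mpoly)\<^sup>2). \<forall>i. lkp m i < 2"
proof -
  let ?m = "Poly_Mapping.single 1 1 + Poly_Mapping.single 2 1 :: nat \<Rightarrow>\<^sub>0 nat"
  let ?e = "\<lambda>(i, j). Poly_Mapping.single i 1 + Poly_Mapping.single j 1 :: nat \<Rightarrow>\<^sub>0 nat"
  let ?P = "{1..n} \<times> {1..n}"
  have "(\<Sum>i\<in>{1..n}. mvar i :: 'k mpoly)\<^sup>2 = (\<Sum>z\<in>?P. Poly_Mapping.single (?e z) 1)"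
    unfolding power2_eq_square sum_product
    by (simp add: sum.cartesian_product mvar_def mult_single case_prod_beta)
  then have "lkp ((\<Sum>i\<in>{1..n}. mvar i :: 'k mpoly)\<^sup>2) ?m = (\<Sum>z\<in>?P. if ?e z = ?m then 1 else 0)"
    by (simp add: lookup_sum lookup_single when_def)
  also have "\<dots> = of_nat (card {z\<in>?P. ?e z = ?m})"
    by (simp add: sum.If_cases Int_def)
  also have "\<dots> \<noteq> 0"
  proof -
    have "(1, 2) \<in> {z\<in>?P. ?e z = ?m}" using assms by auto
    moreover have "finite {z\<in>?P. ?e z = ?m}" by simp
    ultimately have "card {z\<in>?P. ?e z = ?m} > 0" by (subst card_gt_0_iff) blast
    then show ?thesis by (simp only: of_nat_eq_0_iff neq0_conv)
  qed
  finally have "?m \<in> kys ((\<Sum>i\<in>{1..n}. mvar i :: 'k mpoly)\<^sup>2)" by (simp add: in_keys_iff)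
  moreover have "lkp ?m i < 2" for i by (simp add: lookup_add lookup_single when_def)
  ultimately show ?thesis by blast
qed

lemma homogeneous_quotient_colon:
  fixes Q :: "'k::field_char_0 mpoly ring"
  assumes "n \<ge> 2" and Q: "Q = mpoly_ring n"
    and I: "I = Idl\<^bsub>Q\<^esub> {mvar i [^]\<^bsub>Q\<^esub> (2::nat) | i. i \<in> {1..n}}"
    and l: "l = (\<Oplus>\<^bsub>Q\<^esub>i\<in>{1..n}. mvar i)"
    and J: "J = colon Q I (l [^]\<^bsub>Q\<^esub> (2::nat))"
  shows "homogeneous_quotient n J"
proof -
  interpret Q: cring Q unfolding Q by (rule cring_mpoly_ring)
  have G: "{mvar i [^]\<^bsub>Q\<^esub> (2::nat) | i. i \<in> {1..n}} \<subseteq> carrier Q"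
    by (auto simp: Q power2_eq_square intro!: pc_mult pc_mvar)
  interpret I: ideal I Q unfolding I by (rule Q.genideal_ideal[OF G])
  have I_eq: "I = {p \<in> mpoly_carrier n. \<forall>m\<in>kys p. \<exists>i. 2 \<le> lkp m i}"
    unfolding I Q by (rule squares_ideal_eq)
  have l': "l = (\<Sum>i\<in>{1..n}. mvar i)"
    unfolding l Q by (rule finsum_mpoly_ring) (rule pc_mvar)
  have "l \<in> homog n 1" unfolding l' by (intro homog_sum homog_mvar)
  then have l2h: "l\<^sup>2 \<in> homog n 2" using homog_mult[of l n 1 l 1] by (simp add: power2_eq_square numeral_2_eq_2)
  then have l2c: "l\<^sup>2 \<in> mpoly_carrier n" using homog_subset by blast
  have J_iff: "g \<in> J \<longleftrightarrow> g \<in> mpoly_carrier n \<and> g * l\<^sup>2 \<in> I" for g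
    by (simp add: J colon_def Q)
  have I_mult: "p \<in> I \<Longrightarrow> q \<in> mpoly_carrier n \<Longrightarrow> q * p \<in> I" for p q
    using I.I_l_closed[of p q] by (simp add: Q)
  show ?thesis
  proof (rule homogeneous_quotient.intro)
    show "ideal J (mpoly_ring n)"
    proof (rule idealI)
      show "ring (mpoly_ring n :: 'k mpoly ring)" using Q.ring_axioms by (simp add: Q)
      show "subgroup J (add_monoid (mpoly_ring n))"
        unfolding Q[symmetric]
      proof (rule Q.add.subgroupI)
        show "J \<subseteq> carrier Q" by (auto simp: J_iff Q)
        have "0 \<in> J" using I.zero_closed by (simp add: J_iff pc_zero Q)
        then show "J \<noteq> {}" by blast
        fix a assume a: "a \<in> J"
        have ac: "a \<in> mpoly_carrier n" using a by (simp add: J_iff)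
        have "\<ominus>\<^bsub>Q\<^esub> a = - a" using ac Q.minus_equality[of "- a" a] pc_uminus by (auto simp: Q)
        moreover have "(- 1) * (a * l\<^sup>2) \<in> I" 
          by (rule I_mult[OF _ pc_uminus[OF pc_one]]) (use a in \<open>simp add: J_iff\<close>)
        ultimately show "\<ominus>\<^bsub>Q\<^esub> a \<in> J" using ac by (simp add: J_iff pc_uminus)
        fix b assume "b \<in> J"
        then show "a \<oplus>\<^bsub>Q\<^esub> b \<in> J"
          using a I.a_closed[of "a * l\<^sup>2" "b * l\<^sup>2"] by (simp add: Q J_iff pc_add distrib_right)
      qed
    next
      fix a x :: "'k mpoly" assume a: "a \<in> J" and x: "x \<in> carrier (mpoly_ring n)"
      then have "x * (a * l\<^sup>2) \<in> I" using I_mult[of "a * l\<^sup>2" x] by (auto simp: J_iff)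
      then show "x \<otimes>\<^bsub>mpoly_ring n\<^esub> a \<in> J" "a \<otimes>\<^bsub>mpoly_ring n\<^esub> x \<in> J"
        using a x by (auto simp: J_iff pc_mult mult_ac)
    qed
  next
    fix g d assume g: "g \<in> J"
    then have gc: "g \<in> mpoly_carrier n" by (simp add: J_iff)
    have "hcomp d g * l\<^sup>2 = hcomp (d + 2) (g * l\<^sup>2)" using hcomp_mult_homog[OF gc l2h] by simp
    moreover have "hcomp e p \<in> I" if "p \<in> I" for e p
      using that subsetD[OF homog_subset hcomp_homog[of p n e]]
      by (auto simp: I_eq in_keys_iff lookup_hcomp split: if_splits)
    ultimately show "hcomp d g \<in> J"
      using g subsetD[OF homog_subset hcomp_homog[OF gc]] by (auto simp: J_iff)
  next
    fix i assume "i \<in> {1..n}"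
    then have "mvar i * mvar i \<in> I" and "mvar i \<in> (mpoly_carrier n :: 'k mpoly set)"
      using Q.genideal_self[OF G] by (auto simp: I Q power2_eq_square intro: pc_mvar)
    then show "mvar i * mvar i \<in> J"
      using I_mult[of "mvar i * mvar i" "l\<^sup>2"] l2c by (simp add: J_iff pc_mult mult.commute)
  next
    show "1 \<notin> J"
      using linear_form_square_notin[OF \<open>n \<ge> 2\<close>, where 'k = 'k]
      by (auto simp: J_iff I_eq l' not_le)
  qed
qed

corollary standard_graded_colon_quotient:
  fixes Q :: "'k::field_char_0 mpoly ring"
  assumes "n \<ge> 2" and "Q = mpoly_ring n"
    and "I = Idl\<^bsub>Q\<^esub> {mvar i [^]\<^bsub>Q\<^esub> (2::nat) | i. i \<in> {1..n}}"
    and "l = (\<Oplus>\<^bsub>Q\<^esub>i\<in>{1..n}. mvar i)"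
    and "J = colon Q I (l [^]\<^bsub>Q\<^esub> (2::nat))"
  shows "standard_graded_algebra (quot_const n J) (Q Quot J) (quot_homog n J)"
  using homogeneous_quotient.standard_graded[OF homogeneous_quotient_colon[OF assms]] assms(2) by simp

end

theory Submission
  imports Defs
begin

text \<open>
  Write \<open>B n = \<k>[x\<^sub>1,\<dots>,x\<^sub>n] / (x\<^sub>1\<^sup>2,\<dots>,x\<^sub>n\<^sup>2)\<close> and \<open>l n = x\<^sub>1 + \<dots> + x\<^sub>n\<close>. The theorem follows from the
  classical fact that \<open>l n\<close> is a strong Lefschetz element of \<open>B n\<close> in characteristic \<open>0\<close>, in the
  sharp form: multiplication by \<open>(l n)\<^sup>k\<close> on the component of degree \<open>i\<close> is injective if
  \<open>2 i + k \<le> n\<close> and surjective onto the component of degree \<open>i + k\<close> if \<open>2 i + k \<ge> n\<close>.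

  The passage to \<open>A = Q / ((x\<^sub>1\<^sup>2,\<dots>,x\<^sub>n\<^sup>2) : l\<^sup>2)\<close> is immediate, because \<open>g\<close> vanishes in \<open>A\<close> exactly if
  \<open>l\<^sup>2 g\<close> vanishes in \<open>B n\<close>. Hence \<open>l\<^sup>j\<close> is injective on \<open>A i\<close> as soon as \<open>l\<^sup>j\<^sup>+\<^sup>2\<close> is injective on \<open>B i\<close>,
  and it maps \<open>A i\<close> onto the component of degree \<open>i + j\<close> as soon as \<open>l\<^sup>j\<^sup>+\<^sup>2\<close> maps \<open>B i\<close> onto the component of
  degree \<open>i + j + 2\<close>. One of the two applies, according to whether \<open>2 i + j + 2 \<le> n\<close> or not.

  For \<open>B n\<close> both halves are proved by induction on \<open>n\<close>, without counting dimensions. An element of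
  \<open>B (n + 1)\<close> is uniquely \<open>a + x b\<close> with \<open>a\<close>, \<open>b\<close> in \<open>B n\<close> and \<open>x = x\<^bsub>n+1\<^esub>\<close>, and since \<open>x\<^sup>2 = 0\<close>,
  with \<open>l = l n\<close> and \<open>k \<ge> 1\<close>,
  \<open>(l + x)\<^sup>k (a + x b) = l\<^sup>k a + x (l\<^sup>k b + k l\<^sup>k\<^sup>-\<^sup>1 a)\<close>.
  Multiplying the coefficient of \<open>x\<close> by \<open>l\<close> and subtracting \<open>k\<close> times the other coefficient
  leaves \<open>l\<^sup>k\<^sup>+\<^sup>1 b\<close>. So the system is triangular: \<open>b\<close>, of degree \<open>i - 1\<close>, is governed by \<open>l\<^sup>k\<^sup>+\<^sup>1\<close>, and
  then \<open>a\<close>, of degree \<open>i\<close>, by \<open>l\<^sup>k\<^sup>-\<^sup>1\<close>. In both cases the quantity \<open>2 i + k\<close> drops by one, in step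
  with \<open>n\<close>, so that the induction hypothesis applies. The characteristic enters through the division by \<open>k\<close>.
\<close>

section \<open>The monomials divisible by a square\<close>

text \<open>
  This is the ideal \<open>(x\<^sub>i\<^sup>2 | i)\<close> in all the variables at once, so that the same ideal serves every
  stage of an induction on the number of variables.
\<close>

definition square_ideal :: "'k::field mpoly set" where
  "square_ideal = {p. \<forall>m\<in>kys p. \<exists>i. 2 \<le> lkp m i}"

lemma square_ideal_zero: "0 \<in> square_ideal"
  by (simp add: square_ideal_def)

lemma square_ideal_uminus: "p \<in> square_ideal \<Longrightarrow> - p \<in> square_ideal"
  by (simp add: square_ideal_def)

lemma square_ideal_add: "p \<in> square_ideal \<Longrightarrow> q \<in> square_ideal \<Longrightarrow> p + q \<in> square_ideal"
  unfolding square_ideal_def using Poly_Mapping.keys_add[of p q] by blast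

lemma square_ideal_diff: "p \<in> square_ideal \<Longrightarrow> q \<in> square_ideal \<Longrightarrow> p - q \<in> square_ideal"
  using square_ideal_add[OF _ square_ideal_uminus, of p q] by simp

lemma square_ideal_mult:
  assumes "p \<in> square_ideal"
  shows "q * p \<in> square_ideal"
proof -
  have "\<exists>i. 2 \<le> lkp m i" if m: "m \<in> kys (q * p)" for m
  proof -
    obtain a b where ab: "m = a + b" "a \<in> kys q" "b \<in> kys p"
      using subsetD[OF keys_mult m] by blast
    then obtain i where "2 \<le> lkp b i" using assms by (auto simp: square_ideal_def)
    then show ?thesis using ab by (intro exI[of _ i]) (simp add: lookup_add)
  qed
  then show ?thesis by (simp add: square_ideal_def)
qed

lemma square_ideal_mvar_square: "mvar i * mvar i \<in> square_ideal"
proof -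
  have "\<exists>j. 2 \<le> lkp (Poly_Mapping.single i (2::nat)) j" by (rule exI[of _ i]) simp
  then show ?thesis by (simp add: square_ideal_def mvar_square)
qed

lemma mconst_inverse_of_nat:
  "mconst (inverse (of_nat (Suc j))) * (of_nat (Suc j) :: 'k::field_char_0 mpoly) = 1"
proof -
  have "(of_nat (Suc j) :: 'k mpoly) = Poly_Mapping.single 0 (of_nat (Suc j))"
    by (rule single_of_nat[symmetric])
  then have "mconst (inverse (of_nat (Suc j))) * (of_nat (Suc j) :: 'k mpoly)
      = Poly_Mapping.single 0 (inverse (of_nat (Suc j)) * of_nat (Suc j))"
    unfolding mconst_def by (simp only: mult_single add_0_left)
  also have "\<dots> = 1" by (simp del: of_nat_Suc)
  finally show ?thesis .
qed

lemma square_ideal_of_nat_cancel: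
  fixes p :: "'k::field_char_0 mpoly"
  assumes "of_nat (Suc j) * p \<in> square_ideal"
  shows "p \<in> square_ideal"
proof -
  have "mconst (inverse (of_nat (Suc j))) * (of_nat (Suc j) * p) \<in> square_ideal"
    by (rule square_ideal_mult[OF assms])
  then show ?thesis by (simp only: mult.assoc[symmetric] mconst_inverse_of_nat mult_1_left)
qed


section \<open>Homogeneous components and the decomposition along the last variable\<close>

text \<open>
  The components are indexed by integers, those of negative degree being zero, because the
  decomposition \<open>a + x b\<close> lowers the degree of \<open>b\<close> by one, also in degree \<open>0\<close>.
\<close>

definition homog_int :: "nat \<Rightarrow> int \<Rightarrow> 'k::field mpoly set" where
  "homog_int n i = {p \<in> mpoly_carrier n. \<forall>m\<in>kys p. int (mdeg m) = i}"

lemma homog_int_of_nat: "homog_int n (int d) = homog n d"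
  by (simp add: homog_int_def homog_def)

lemma homog_int_carrier: "p \<in> homog_int n i \<Longrightarrow> p \<in> mpoly_carrier n"
  by (simp add: homog_int_def)

lemma homog_int_zero: "0 \<in> homog_int n i"
  by (simp add: homog_int_def pc_zero)

lemma homog_int_uminus: "p \<in> homog_int n i \<Longrightarrow> - p \<in> homog_int n i"
  by (simp add: homog_int_def pc_uminus)

lemma homog_int_add: "p \<in> homog_int n i \<Longrightarrow> q \<in> homog_int n i \<Longrightarrow> p + q \<in> homog_int n i"
  unfolding homog_int_def using pc_add[of p n q] Poly_Mapping.keys_add[of p q] by blast

lemma homog_int_diff: "p \<in> homog_int n i \<Longrightarrow> q \<in> homog_int n i \<Longrightarrow> p - q \<in> homog_int n i"
  using homog_int_add[OF _ homog_int_uminus, of p n i q] by simp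

lemma homog_int_mult:
  assumes "p \<in> homog_int n i" "q \<in> homog_int n j" "k = i + j"
  shows "p * q \<in> homog_int n k"
proof -
  have "int (mdeg m) = k" if m: "m \<in> kys (p * q)" for m
  proof -
    obtain a b where "m = a + b" "a \<in> kys p" "b \<in> kys q"
      using subsetD[OF keys_mult m] by blast
    then show ?thesis using assms by (simp add: mdeg_add homog_int_def)
  qed
  then show ?thesis using assms pc_mult[of p n q] by (simp add: homog_int_def)
qed

lemma homog_int_one: "1 \<in> homog_int n 0"
  by (simp add: homog_int_def pc_one)

lemma homog_int_power: "p \<in> homog_int n 1 \<Longrightarrow> p ^ k \<in> homog_int n (int k)"
  by (induct k) (auto simp: homog_int_one intro: homog_int_mult)

lemma homog_int_mconst: "mconst c \<in> homog_int n 0"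
  by (simp add: homog_int_def pc_mconst) (simp add: mconst_def)

lemma homog_int_of_nat_mult: "p \<in> homog_int n i \<Longrightarrow> of_nat c * p \<in> homog_int n i"
  by (induct c) (auto simp: homog_int_zero homog_int_add distrib_right)

lemma homog_int_mvar: "j \<in> {1..n} \<Longrightarrow> mvar j \<in> homog_int n 1"
  using homog_mvar[of j n] by (simp flip: homog_int_of_nat)

lemma homog_int_mono: "n \<le> n' \<Longrightarrow> p \<in> homog_int n i \<Longrightarrow> p \<in> homog_int n' i"
  by (fastforce simp: homog_int_def mpoly_carrier_def)

lemma homog_int_no_variables:
  assumes "p \<in> homog_int 0 i" "i \<noteq> 0"
  shows "p = 0"
proof -
  have "m \<notin> kys p" for m
  proof
    assume m: "m \<in> kys p"
    then have "kys m = {}" "int (mdeg m) = i"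
      using assms by (auto simp: homog_int_def mpoly_carrier_def simp del: keys_eq_empty)
    then show False using assms(2) by (simp add: mdeg_def)
  qed
  then show ?thesis by (metis all_not_in_conv keys_eq_empty)
qed

text \<open>
  Sorting the monomials of \<open>p\<close> by the exponent of the last variable gives \<open>a\<close> (exponent \<open>0\<close>),
  \<open>x b\<close> (exponent \<open>1\<close>), and a remainder in the ideal.
\<close>

lemma last_variable_split:
  assumes "p \<in> homog_int (Suc n) i"
  obtains a b where "a \<in> homog_int n i" "b \<in> homog_int n (i - 1)"
    "p - (a + mvar (Suc n) * b) \<in> square_ideal"
proof -
  define splits where "splits p \<longleftrightarrow> (\<exists>a\<in>homog_int n i. \<exists>b\<in>homog_int n (i - 1).
      p - (a + mvar (Suc n) * b) \<in> square_ideal)" for p :: "'a mpoly"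
  have zero: "splits 0"
    unfolding splits_def by (intro bexI[of _ 0]) (auto simp: homog_int_zero square_ideal_zero)
  have add: "splits (p + q)" if p: "splits p" and q: "splits q" for p q
  proof -
    obtain a b where 1: "a \<in> homog_int n i" "b \<in> homog_int n (i - 1)"
      "p - (a + mvar (Suc n) * b) \<in> square_ideal" using p by (auto simp: splits_def)
    obtain c d where 2: "c \<in> homog_int n i" "d \<in> homog_int n (i - 1)"
      "q - (c + mvar (Suc n) * d) \<in> square_ideal" using q by (auto simp: splits_def)
    have "p + q - ((a + c) + mvar (Suc n) * (b + d))
        = (p - (a + mvar (Suc n) * b)) + (q - (c + mvar (Suc n) * d))"
      by (simp add: algebra_simps)
    then have "p + q - ((a + c) + mvar (Suc n) * (b + d)) \<in> square_ideal"
      using square_ideal_add[OF 1(3) 2(3)] by metis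
    then show ?thesis unfolding splits_def using 1 2 homog_int_add by blast
  qed
  have monomial: "splits (Poly_Mapping.single m c)"
    if m: "kys m \<subseteq> {1..Suc n}" "int (mdeg m) = i" for m c
  proof -
    consider "Suc n \<notin> kys m" | "lkp m (Suc n) = 1" | "2 \<le> lkp m (Suc n)"
      by (auto simp: in_keys_iff) linarith
    then show ?thesis
    proof cases
      case 1
      then have "kys m \<subseteq> {1..n}" using m(1) by (auto simp: subset_eq le_Suc_eq)
      then have "Poly_Mapping.single m c \<in> homog_int n i"
        using m(2) by (simp add: homog_int_def pc_single)
      then show ?thesis unfolding splits_def
        by (intro bexI[of _ "Poly_Mapping.single m c"] bexI[of _ 0])
          (auto simp: homog_int_zero square_ideal_zero)
    next
      case 2
      then have "Suc n \<in> kys m" by (simp add: in_keys_iff)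
      then obtain m' where m': "m = Poly_Mapping.single (Suc n) 1 + m'"
        "mdeg m = Suc (mdeg m')" "kys m' \<subseteq> kys m" by (rule single_split)
      have "Suc n \<notin> kys m'" using 2 by (simp add: m'(1) lookup_add in_keys_iff)
      then have "kys m' \<subseteq> {1..n}" using m(1) m'(3) by (auto simp: subset_eq le_Suc_eq)
      then have "Poly_Mapping.single m' c \<in> homog_int n (i - 1)"
        using m(2) m'(2) by (simp add: homog_int_def pc_single)
      moreover have "Poly_Mapping.single m c = mvar (Suc n) * Poly_Mapping.single m' c"
        by (simp add: m'(1) mvar_def mult_single)
      ultimately show ?thesis unfolding splits_def
        by (intro bexI[of _ 0] bexI[of _ "Poly_Mapping.single m' c"])
          (auto simp: homog_int_zero square_ideal_zero)
    next
      case 3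
      then have "Poly_Mapping.single m c \<in> square_ideal" by (auto simp: square_ideal_def)
      then show ?thesis unfolding splits_def
        by (intro bexI[of _ 0]) (auto simp: homog_int_zero)
    qed
  qed
  have "splits (\<Sum>m\<in>K. Poly_Mapping.single m (lkp p m))" if "finite K" "K \<subseteq> kys p" for K
    using that
  proof (induct K)
    case (insert m K)
    have "splits (Poly_Mapping.single m (lkp p m))"
      using insert.prems assms by (intro monomial) (auto simp: homog_int_def mpoly_carrier_def)
    then show ?case using insert add by simp
  qed (simp add: zero)
  from this[OF finite_keys subset_refl] have "splits p" by (simp flip: mpoly_expand)
  then show ?thesis using that by (auto simp: splits_def)
qed

lemma lookup_single_times: "lkp (Poly_Mapping.single e 1 * b) (e + m) = lkp b m"
  for e m :: "nat \<Rightarrow>\<^sub>0 nat" and b :: "'k::field mpoly"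
proof -
  have "Poly_Mapping.single e 1 * b = (\<Sum>m\<in>kys b. Poly_Mapping.single (e + m) (lkp b m))"
    by (subst mpoly_expand) (simp add: sum_distrib_left mult_single)
  then show ?thesis
    by (simp add: lookup_sum lookup_single when_def in_keys_iff)
qed

text \<open>
  Shifting a monomial of \<open>b\<close> by \<open>x\<close> produces a monomial of \<open>x b\<close> that cannot cancel against \<open>a\<close>, and
  it is divisible by a square only if the original monomial is.
\<close>

lemma last_variable_independent:
  assumes a: "a \<in> mpoly_carrier n" and b: "b \<in> mpoly_carrier n"
    and ab: "a + mvar (Suc n) * b \<in> square_ideal"
  shows "a \<in> square_ideal" "b \<in> square_ideal"
proof -
  let ?e = "Poly_Mapping.single (Suc n) 1 :: nat \<Rightarrow>\<^sub>0 nat"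
  have "\<exists>i. 2 \<le> lkp m i" if m: "m \<in> kys b" for m
  proof -
    have "kys m \<subseteq> {1..n}" using m b by (simp add: mpoly_carrier_def)
    then have "Suc n \<notin> kys m" by auto
    then have mn: "lkp m (Suc n) = 0" by (simp add: in_keys_iff)
    have "Suc n \<in> kys (?e + m)" by (simp add: keys_add_nat)
    then have "lkp a (?e + m) = 0"
      using a by (fastforce simp: mpoly_carrier_def simp flip: not_in_keys_iff_lookup_eq_zero)
    then have "lkp (a + mvar (Suc n) * b) (?e + m) = lkp b m"
      by (simp add: lookup_add mvar_def lookup_single_times del: One_nat_def)
    then have "?e + m \<in> kys (a + mvar (Suc n) * b)" using m by (simp add: in_keys_iff)
    then obtain i where i: "2 \<le> lkp (?e + m) i" using ab by (auto simp: square_ideal_def)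
    then have "i \<noteq> Suc n" using mn by (auto simp: lookup_add)
    then show ?thesis using i by (auto simp: lookup_add lookup_single when_def)
  qed
  then show "b \<in> square_ideal" by (simp add: square_ideal_def)
  then have "(a + mvar (Suc n) * b) - mvar (Suc n) * b \<in> square_ideal"
    by (intro square_ideal_diff ab square_ideal_mult)
  then show "a \<in> square_ideal" by simp
qed


section \<open>The Lefschetz property modulo squares\<close>

definition sum_of_variables :: "nat \<Rightarrow> 'k::field mpoly" where
  "sum_of_variables n = (\<Sum>i\<in>{1..n}. mvar i)"

lemma sum_of_variables_Suc: "sum_of_variables (Suc n) = sum_of_variables n + mvar (Suc n)"
  by (simp add: sum_of_variables_def)

lemma sum_of_variables_homog: "sum_of_variables n \<in> homog n 1"
  unfolding sum_of_variables_def by (intro homog_sum homog_mvar)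

lemma sum_of_variables_homog_int: "sum_of_variables n \<in> homog_int n 1"
  using sum_of_variables_homog[of n] by (simp flip: homog_int_of_nat)

lemma power_Suc_add_modulo_square:
  fixes l x :: "'a::comm_ring_1"
  obtains c where "(l + x) ^ Suc j = l ^ Suc j + of_nat (Suc j) * (l ^ j * x) + x * x * c"
proof -
  have "\<exists>c. (l + x) ^ Suc j = l ^ Suc j + of_nat (Suc j) * (l ^ j * x) + x * x * c"
  proof (induct j)
    case 0
    show ?case by (intro exI[of _ 0]) simp
  next
    case (Suc j)
    then obtain c where c: "(l + x) ^ Suc j = l ^ Suc j + of_nat (Suc j) * (l ^ j * x) + x * x * c"
      by blast
    show ?case
      by (subst power_Suc, subst c, intro exI[of _ "of_nat (Suc j) * l ^ j + (l + x) * c"])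
        (simp add: algebra_simps)
  qed
  then show ?thesis using that by blast
qed

lemma power_times_split_modulo_squares:
  fixes n :: nat and l a b :: "'k::field mpoly"
  defines "x \<equiv> mvar (Suc n)"
  shows "(l + x) ^ Suc j * (a + x * b)
      - (l ^ Suc j * a + x * (l ^ Suc j * b + of_nat (Suc j) * (l ^ j * a))) \<in> square_ideal"
proof -
  obtain c where c: "(l + x) ^ Suc j = l ^ Suc j + of_nat (Suc j) * (l ^ j * x) + x * x * c"
    by (rule power_Suc_add_modulo_square)
  have "(l + x) ^ Suc j * (a + x * b)
      - (l ^ Suc j * a + x * (l ^ Suc j * b + of_nat (Suc j) * (l ^ j * a)))
      = (c * (a + x * b) + of_nat (Suc j) * (l ^ j * b)) * (x * x)"
    unfolding c by (simp add: algebra_simps)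
  also have "\<dots> \<in> square_ideal"
    unfolding x_def by (intro square_ideal_mult square_ideal_mvar_square)
  finally show ?thesis .
qed

text \<open>
  Comparing coefficients of \<open>x\<close>, a relation \<open>(l + x)\<^sup>k (a + x b) = 0\<close> says \<open>l\<^sup>k a = 0\<close> and
  \<open>l\<^sup>k b + k l\<^sup>k\<^sup>-\<^sup>1 a = 0\<close>; times \<open>l\<close>, the second gives \<open>l\<^sup>k\<^sup>+\<^sup>1 b = 0\<close>, hence \<open>b = 0\<close> and then \<open>a = 0\<close>.
\<close>

theorem lefschetz_injective_modulo_squares:
  fixes v :: "'k::field_char_0 mpoly"
  assumes "v \<in> homog_int n i" "2 * i + int k \<le> int n"
    and "sum_of_variables n ^ k * v \<in> square_ideal"
  shows "v \<in> square_ideal"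
  using assms
proof (induct n arbitrary: v i k)
  case 0
  show ?case
  proof (cases "i = 0")
    case True
    then have "k = 0" using 0 by simp
    then show ?thesis using 0 by simp
  next
    case False
    then show ?thesis using 0 homog_int_no_variables square_ideal_zero by blast
  qed
next
  case (Suc n)
  show ?case
  proof (cases k)
    case 0
    then show ?thesis using Suc.prems by simp
  next
    case (Suc j)
    note k = this
    let ?x = "mvar (Suc n) :: 'k mpoly" and ?l = "sum_of_variables n :: 'k mpoly"
    obtain a b where a: "a \<in> homog_int n i" and b: "b \<in> homog_int n (i - 1)"
      and v: "v - (a + ?x * b) \<in> square_ideal"
      using last_variable_split[OF Suc.prems(1)] by blast
    define P where "P = ?l ^ Suc j * a"
    define R where "R = ?l ^ Suc j * b + of_nat (Suc j) * (?l ^ j * a)"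
    note [simp del] = of_nat_Suc
    have mod: "(?l + ?x) ^ Suc j * (a + ?x * b) - (P + ?x * R) \<in> square_ideal"
      unfolding P_def R_def by (rule power_times_split_modulo_squares)
    have lv: "(?l + ?x) ^ Suc j * v \<in> square_ideal"
      using Suc.prems(3) by (simp only: k sum_of_variables_Suc)
    have "P + ?x * R = (?l + ?x) ^ Suc j * v - (?l + ?x) ^ Suc j * (v - (a + ?x * b))
        - ((?l + ?x) ^ Suc j * (a + ?x * b) - (P + ?x * R))"
      by (simp add: algebra_simps)
    also have "\<dots> \<in> square_ideal"
      by (rule square_ideal_diff[OF square_ideal_diff[OF lv square_ideal_mult[OF v]] mod])
    finally have PxR: "P + ?x * R \<in> square_ideal" .
    have l_pow: "?l ^ m \<in> mpoly_carrier n" for m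
      by (rule homog_int_carrier[OF homog_int_power[OF sum_of_variables_homog_int]])
    have "P \<in> mpoly_carrier n"
      unfolding P_def by (intro pc_mult l_pow homog_int_carrier[OF a])
    moreover have "R \<in> mpoly_carrier n"
      unfolding R_def using a b
      by (intro pc_add pc_mult[OF l_pow] homog_int_carrier[OF homog_int_of_nat_mult]
          homog_int_carrier[OF b] homog_int_mult[OF homog_int_power[OF sum_of_variables_homog_int] a]) auto
    ultimately have P: "P \<in> square_ideal" and R: "R \<in> square_ideal"
      using last_variable_independent[OF _ _ PxR] by auto
    have "?l ^ Suc (Suc j) * b = ?l * R - of_nat (Suc j) * P"
      unfolding P_def R_def by (simp add: algebra_simps)
    also have "\<dots> \<in> square_ideal" by (intro square_ideal_diff square_ideal_mult P R)
    finally have b0: "b \<in> square_ideal"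
      using Suc.hyps[OF b, of "Suc (Suc j)"] Suc.prems(2) k by simp
    have "of_nat (Suc j) * (?l ^ j * a) = R - ?l ^ Suc j * b"
      unfolding R_def by simp
    also have "\<dots> \<in> square_ideal" by (intro square_ideal_diff square_ideal_mult R b0)
    finally have "?l ^ j * a \<in> square_ideal" by (rule square_ideal_of_nat_cancel)
    then have a0: "a \<in> square_ideal" using Suc.hyps[OF a, of j] Suc.prems(2) k by simp
    have "(v - (a + ?x * b)) + (a + ?x * b) \<in> square_ideal"
      by (intro square_ideal_add square_ideal_mult v a0 b0)
    then show ?thesis by simp
  qed
qed

text \<open>
  To reach \<open>r + x s\<close>, solve \<open>l\<^sup>k\<^sup>+\<^sup>1 b = l s - k r\<close> first and then \<open>k l\<^sup>k\<^sup>-\<^sup>1 a = s - l\<^sup>k b\<close>. The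
  coefficient of \<open>x\<close> is then \<open>s\<close>, and the remaining equation \<open>l\<^sup>k a = r\<close> follows, up to the factor \<open>k\<close>,
  by multiplying the second equation by \<open>l\<close> and inserting the first.
\<close>

theorem lefschetz_surjective_modulo_squares:
  fixes w :: "'k::field_char_0 mpoly"
  assumes "w \<in> homog_int n (i + int k)" "2 * i + int k \<ge> int n"
  shows "\<exists>v\<in>homog_int n i. sum_of_variables n ^ k * v - w \<in> square_ideal"
  using assms
proof (induct n arbitrary: w i k)
  case 0
  show ?case
  proof (cases "i + int k = 0")
    case True
    then have "k = 0" using 0 by simp
    then show ?thesis using 0 by (intro bexI[of _ w]) (auto simp: square_ideal_zero)
  next
    case False
    then have "w = 0" using 0 homog_int_no_variables by blast
    then show ?thesis by (intro bexI[of _ 0]) (auto simp: square_ideal_zero homog_int_zero)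
  qed
next
  case (Suc n)
  show ?case
  proof (cases k)
    case 0
    then show ?thesis using Suc.prems by (intro bexI[of _ w]) (auto simp: square_ideal_zero)
  next
    case (Suc j)
    note k = this
    let ?x = "mvar (Suc n) :: 'k mpoly" and ?l = "sum_of_variables n :: 'k mpoly"
    let ?c = "of_nat (Suc j) :: 'k mpoly"
    note [simp del] = of_nat_Suc
    obtain r s where r: "r \<in> homog_int n (i + int k)" and s: "s \<in> homog_int n (i + int k - 1)"
      and w: "w - (r + ?x * s) \<in> square_ideal"
      using last_variable_split[OF Suc.prems(1)] by blast
    have "?l * s - ?c * r \<in> homog_int n ((i - 1) + int (Suc (Suc j)))"
      using r k by (intro homog_int_diff homog_int_of_nat_mult
          homog_int_mult[OF sum_of_variables_homog_int s]) (auto simp: of_nat_Suc algebra_simps)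
    then obtain b where b: "b \<in> homog_int n (i - 1)"
      and lb: "?l ^ Suc (Suc j) * b - (?l * s - ?c * r) \<in> square_ideal"
      using Suc.hyps[of _ "i - 1" "Suc (Suc j)"] Suc.prems(2) k by (auto simp: of_nat_Suc)
    have "s - ?l ^ Suc j * b \<in> homog_int n (i + int j)"
      using s k by (intro homog_int_diff
          homog_int_mult[OF homog_int_power[OF sum_of_variables_homog_int] b])
        (auto simp: of_nat_Suc algebra_simps)
    then obtain a' where a': "a' \<in> homog_int n i"
      and la': "?l ^ j * a' - (s - ?l ^ Suc j * b) \<in> square_ideal"
      using Suc.hyps[of _ i j] Suc.prems(2) k by (auto simp: of_nat_Suc)
    define a where "a = mconst (inverse (of_nat (Suc j))) * a'"
    have a: "a \<in> homog_int n i"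
      unfolding a_def by (rule homog_int_mult[OF homog_int_mconst a']) simp
    have ca: "?c * a = a'"
    proof -
      have "?c * a = (mconst (inverse (of_nat (Suc j))) * ?c) * a'"
        unfolding a_def by (simp only: mult_ac)
      then show ?thesis by (simp only: mconst_inverse_of_nat mult_1_left)
    qed
    have "?c * (?l ^ Suc j * a - r) = ?l ^ Suc j * (?c * a) - ?c * r"
      by (simp only: algebra_simps)
    also have "\<dots> = ?l * (?l ^ j * a' - (s - ?l ^ Suc j * b))
        - (?l ^ Suc (Suc j) * b - (?l * s - ?c * r))"
      unfolding ca by (simp add: algebra_simps)
    also have "\<dots> \<in> square_ideal" by (intro square_ideal_diff square_ideal_mult la' lb)
    finally have r_eq: "?l ^ Suc j * a - r \<in> square_ideal" by (rule square_ideal_of_nat_cancel)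
    have cla: "?c * (?l ^ j * a) = ?l ^ j * a'"
      unfolding ca[symmetric] by (simp only: mult_ac)
    define P where "P = ?l ^ Suc j * a"
    define R where "R = ?l ^ Suc j * b + ?c * (?l ^ j * a)"
    have s_eq: "R - s \<in> square_ideal"
      using la' unfolding R_def cla by (simp add: algebra_simps)
    have mod: "(?l + ?x) ^ Suc j * (a + ?x * b) - (P + ?x * R) \<in> square_ideal"
      unfolding P_def R_def by (rule power_times_split_modulo_squares)
    have "(?l + ?x) ^ Suc j * (a + ?x * b) - w
        = ((?l + ?x) ^ Suc j * (a + ?x * b) - (P + ?x * R)) + (P - r) + ?x * (R - s)
          - (w - (r + ?x * s))"
      by (simp add: algebra_simps)
    also have "\<dots> \<in> square_ideal"
      by (rule square_ideal_diff[OF square_ideal_add[OF square_ideal_add[OF mod r_eq[folded P_def]]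
          square_ideal_mult[OF s_eq]] w])
    finally have "sum_of_variables (Suc n) ^ k * (a + ?x * b) - w \<in> square_ideal"
      by (simp only: k sum_of_variables_Suc)
    moreover have "a + ?x * b \<in> homog_int (Suc n) i"
      using homog_int_mult[OF homog_int_mvar[of "Suc n" "Suc n"] homog_int_mono[OF _ b, of "Suc n"], of i]
        homog_int_mono[OF _ a, of "Suc n"] by (auto intro: homog_int_add)
    ultimately show ?thesis by blast
  qed
qed


section \<open>Transfer to the colon quotient\<close>

theorem proposition5p5:
  fixes n :: nat
    and Q :: "'k::field_char_0 mpoly ring"
    and I J :: "'k mpoly set"
    and l :: "'k mpoly"
  assumes "n \<ge> 2"
    and "Q = mpoly_ring n"
    and "I = Idl\<^bsub>Q\<^esub> {mvar i [^]\<^bsub>Q\<^esub> (2::nat) | i. i \<in> {1..n}}"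
    and "l = (\<Oplus>\<^bsub>Q\<^esub>i\<in>{1..n}. mvar i)"
    and "J = colon Q I (l [^]\<^bsub>Q\<^esub> (2::nat))"
  shows "strong_lefschetz_algebra (quot_const n J) (Q Quot J) (quot_homog n J)"
proof -
  interpret HQ: homogeneous_quotient n J by (rule homogeneous_quotient_colon[OF assms])
  let ?A = "Q Quot J" and ?l = "sum_of_variables n :: 'k mpoly"
  let ?cl = "HQ.coset_of"
  have l: "l = ?l"
    unfolding assms(4) assms(2) sum_of_variables_def by (rule finsum_mpoly_ring) (rule pc_mvar)
  have l_homog: "?l ^ j \<in> homog n j" for j
    using homog_int_power[OF sum_of_variables_homog_int, of n j] by (simp only: homog_int_of_nat)
  have l_carrier: "?l ^ j \<in> mpoly_carrier n" for j using l_homog homog_subset by blast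
  have I: "I = {p \<in> mpoly_carrier n. p \<in> square_ideal}"
    unfolding assms(3) assms(2) squares_ideal_eq square_ideal_def by simp
  have J_iff: "g \<in> J \<longleftrightarrow> ?l\<^sup>2 * g \<in> square_ideal" if "g \<in> mpoly_carrier n" for g
    using that pc_mult[OF that l_carrier[of 2]]
    by (simp add: assms(5) assms(2) colon_def I l mult.commute)
  have cl_mult: "?cl p \<otimes>\<^bsub>?A\<^esub> ?cl q = ?cl (p * q)"
    if "p \<in> mpoly_carrier n" "q \<in> mpoly_carrier n" for p q
    using HQ.coset_mult[OF that] by (simp add: assms(2))
  have cl_power: "?cl ?l [^]\<^bsub>?A\<^esub> j = ?cl (?l ^ j)" for j :: nat
  proof (induct j)
    case 0
    show ?case using HQ.coset_one by (simp add: assms(2) nat_pow_def)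
  next
    case (Suc j)
    have "?cl ?l [^]\<^bsub>?A\<^esub> Suc j = ?cl ?l [^]\<^bsub>?A\<^esub> j \<otimes>\<^bsub>?A\<^esub> ?cl ?l"
      by (simp add: nat_pow_def)
    then show ?case
      using Suc cl_mult[OF l_carrier[of j] l_carrier[of 1]] by (simp add: mult.commute)
  qed
  have max_rank: "maximal_rank_element ?A (quot_homog n J) j (?cl ?l [^]\<^bsub>?A\<^esub> j)"
    if "j \<ge> 1" for j
    unfolding maximal_rank_element_def cl_power
  proof (intro conjI allI that)
    show "?cl (?l ^ j) \<in> quot_homog n J j" using l_homog by (auto simp: quot_homog_def)
    fix i
    let ?mul = "\<lambda>a. a \<otimes>\<^bsub>?A\<^esub> ?cl (?l ^ j)"
    show "inj_on ?mul (quot_homog n J i) \<or> ?mul ` quot_homog n J i = quot_homog n J (i + j)"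
    proof (cases "2 * i + j + 2 \<le> n")
      case True
      have "inj_on ?mul (quot_homog n J i)"
      proof (rule inj_onI)
        fix a b assume ab: "a \<in> quot_homog n J i" "b \<in> quot_homog n J i" "?mul a = ?mul b"
        obtain p q where p: "p \<in> homog n i" "a = ?cl p" and q: "q \<in> homog n i" "b = ?cl q"
          using ab by (auto simp: quot_homog_def)
        have pc: "p \<in> mpoly_carrier n" and qc: "q \<in> mpoly_carrier n"
          using p q homog_subset by blast+
        have d: "p - q \<in> homog_int n (int i)"
          using p q by (intro homog_int_diff) (simp_all add: homog_int_of_nat)
        have "?cl (p * ?l ^ j) = ?cl (q * ?l ^ j)"
          using ab(3) cl_mult[OF _ l_carrier] pc qc p q by simp
        then have "p * ?l ^ j - q * ?l ^ j \<in> J"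
          using HQ.coset_eq[OF pc_mult[OF pc l_carrier] pc_mult[OF qc l_carrier]] by simp
        then have "?l\<^sup>2 * (p * ?l ^ j - q * ?l ^ j) \<in> square_ideal"
          using J_iff HQ.J_sub by blast
        also have "?l\<^sup>2 * (p * ?l ^ j - q * ?l ^ j) = ?l ^ (j + 2) * (p - q)"
          by (simp add: algebra_simps power_add power2_eq_square)
        finally have "p - q \<in> square_ideal"
          by (rule lefschetz_injective_modulo_squares[OF d, rotated]) (use True in simp)
        then have "p - q \<in> J"
          using J_iff[OF homog_int_carrier[OF d]] square_ideal_mult by blast
        then show "a = b" using HQ.coset_eq[OF pc qc] p q by simp
      qed
      then show ?thesis ..
    next
      case False
      have "quot_homog n J (i + j) \<subseteq> ?mul ` quot_homog n J i"
      proof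
        fix b assume "b \<in> quot_homog n J (i + j)"
        then obtain q where q: "q \<in> homog n (i + j)" "b = ?cl q" by (auto simp: quot_homog_def)
        have qc: "q \<in> mpoly_carrier n" using q homog_subset by blast
        have "?l\<^sup>2 * q \<in> homog n (2 + (i + j))" by (rule homog_mult[OF l_homog q(1)])
        then have "?l\<^sup>2 * q \<in> homog_int n (int i + int (j + 2))"
          by (simp add: algebra_simps flip: homog_int_of_nat)
        then obtain v where v: "v \<in> homog_int n (int i)"
          and lv: "?l ^ (j + 2) * v - ?l\<^sup>2 * q \<in> square_ideal"
          using lefschetz_surjective_modulo_squares[of "?l\<^sup>2 * q" n "int i" "j + 2"] False by auto
        have vc: "v \<in> mpoly_carrier n" by (rule homog_int_carrier[OF v])
        have diff: "v * ?l ^ j - q \<in> mpoly_carrier n"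
          using pc_add[OF pc_mult[OF vc l_carrier] pc_uminus[OF qc], of j] by simp
        have "?l\<^sup>2 * (v * ?l ^ j - q) = ?l ^ (j + 2) * v - ?l\<^sup>2 * q"
          by (simp add: algebra_simps power_add power2_eq_square)
        then have "v * ?l ^ j - q \<in> J" using J_iff[OF diff] lv by simp
        then have "?cl (v * ?l ^ j) = b"
          using HQ.coset_eq[OF pc_mult[OF vc l_carrier] qc] q by simp
        then have "b = ?mul (?cl v)" using cl_mult[OF vc l_carrier] by simp
        moreover have "?cl v \<in> quot_homog n J i"
          using v by (auto simp: quot_homog_def homog_int_of_nat)
        ultimately show "b \<in> ?mul ` quot_homog n J i" by blast
      qed
      moreover have "?mul ` quot_homog n J i \<subseteq> quot_homog n J (i + j)"
        using HQ.component_mult_A[of _ i "?cl (?l ^ j)" j] l_homog[of j]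
        by (auto simp: assms(2) quot_homog_def)
      ultimately show ?thesis by blast
    qed
  qed
  have "?cl ?l \<in> quot_homog n J 1" using sum_of_variables_homog by (auto simp: quot_homog_def)
  then show ?thesis
    using max_rank
    by (intro strong_lefschetz_algebra.intro strong_lefschetz_algebra_axioms.intro
        standard_graded_colon_quotient[OF assms]) blast
qed

end
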